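(* Let $\mathcal{V}$ be a finite ground set, let $k\ge 2$ and $1\le\tau\le k$ be integers with $|\mathcal{V}|\ge k$, and let $h:\mathcal{H}(\mathcal{V})\to\mathbb{R}_{\ge 0}$ with $h(())=0$ be forward-monotone, backward-monotone and general-sequence-submodular. Let $S$ be the sequence output by Algorithm 2 with parameters $k,\tau$. Then $$\min_{\mathcal{V}'\subseteq\mathcal{V}(S),\,|\mathcal{V}'|\le \tau} h(S-\mathcal{V}')\;\ge\;\frac{1-1/e}{1+\tau}\cdot\max_{S'\in\mathcal{H}(\mathcal{V}),\,|S'|\le k}\ \min_{\mathcal{V}'\subseteq\mathcal{V}(S'),\,|\mathcal{V}'|\le \tau} h(S'-\mathcal{V}').$$
   Context: $\mathcal{H}(\mathcal{V})$ denotes the set of all finite sequences $(v_1,\dots,v_m)$ of pairwise distinct elements of $\mathcal{V}$ ($0\le m\le|\mathcal{V}|$), including the empty sequence $()$. For $S\in\mathcal{H}(\mathcal{V})$, $\mathcal{V}(S)$ is the set of its elements and $|S|=|\mathcal{V}(S)|$. For a set $\mathcal{U}$, $S-\mathcal{U}$ is the sequence obtained from $S$ by deleting the elements of $\mathcal{U}$ and keeping the order of the remaining elements; $S_1$ is a subsequence of $S_2$ if $S_1=S_2-\mathcal{U}$ for some $\mathcal{U}\subseteq\mathcal{V}(S_2)$. For $S_1=(v_1,\dots,v_{m_1})$ and $S_2\in\mathcal{H}(\mathcal{V})$ with $S_2-\mathcal{V}(S_1)=(w_1,\dots,w_{m_3})$, the concatenation is $S_1\oplus S_2=(v_1,\dots,v_{m_1},w_1,\dots,w_{m_3})$.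 Marginal value: $h(S_2\mid S_1)=h(S_1\oplus S_2)-h(S_1)$; $(v)$ is the one-element sequence. $h$ is forward-monotone if $h(S_1\oplus S_2)\ge h(S_1)$ for all $S_1,S_2$; backward-monotone if $h(S_1\oplus S_2)\ge h(S_2)$ for all $S_1,S_2$; general-sequence-submodular if $h(S_3\mid S_1)\ge h(S_3\mid S_2)$ for all $S_3$ and all $S_1,S_2$ such that $S_1$ is a subsequence of $S_2$. Algorithm 2 (parameters $k$, $\tau$): Step 1: start with $S_1=()$ and, while $|S_1|<\tau$, set $S_1=S_1\oplus(v)$ with $v\in\arg\max_{v\in\mathcal{V}\setminus\mathcal{V}(S_1)}h((v))$. Step 2: start with $S_2=()$ and, while $|S_2|<k-\tau$, set $S_2=S_2\oplus(v)$ with $v\in\arg\max_{v\in\mathcal{V}\setminus(\mathcal{V}(S_1)\cup\mathcal{V}(S_2))}h((v)\mid S_2)$. Output $S=S_1\oplus S_2$. Ties are broken arbitrarily. *)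

theory Defs
  imports Complex_Main
begin

definition seqs :: "'a set \<Rightarrow> 'a list set" where
  "seqs V = {S. distinct S \<and> set S \<subseteq> V}"

definition del :: "'a list \<Rightarrow> 'a set \<Rightarrow> 'a list"  (infixl \<open>\<ominus>\<close> 65) where
  "S \<ominus> U = filter (\<lambda>v. v \<notin> U) S"

definition is_subsequence :: "'a list \<Rightarrow> 'a list \<Rightarrow> bool" where
  "is_subsequence S1 S2 \<longleftrightarrow> (\<exists>U \<subseteq> set S2. S1 = S2 \<ominus> U)"

definition seq_concat :: "'a list \<Rightarrow> 'a list \<Rightarrow> 'a list"  (infixl \<open>\<oplus>\<close> 65) where
  "S1 \<oplus> S2 = S1 @ (S2 \<ominus> set S1)"

text \<open>\<open>marginal h S2 S1\<close> is \<open>h(S2 | S1)\<close>, the value of appending \<open>S2\<close> to \<open>S1\<close>.\<close>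

definition marginal :: "('a list \<Rightarrow> real) \<Rightarrow> 'a list \<Rightarrow> 'a list \<Rightarrow> real" where
  "marginal h S2 S1 = h (S1 \<oplus> S2) - h S1"

definition forward_monotone :: "'a set \<Rightarrow> ('a list \<Rightarrow> real) \<Rightarrow> bool" where
  "forward_monotone V h \<longleftrightarrow> (\<forall>S1 \<in> seqs V. \<forall>S2 \<in> seqs V. h (S1 \<oplus> S2) \<ge> h S1)"

definition backward_monotone :: "'a set \<Rightarrow> ('a list \<Rightarrow> real) \<Rightarrow> bool" where
  "backward_monotone V h \<longleftrightarrow> (\<forall>S1 \<in> seqs V. \<forall>S2 \<in> seqs V. h (S1 \<oplus> S2) \<ge> h S2)"

definition general_sequence_submodular :: "'a set \<Rightarrow> ('a list \<Rightarrow> real) \<Rightarrow> bool" where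
  "general_sequence_submodular V h \<longleftrightarrow>
     (\<forall>S1 \<in> seqs V. \<forall>S2 \<in> seqs V. \<forall>S3 \<in> seqs V.
        is_subsequence S1 S2 \<longrightarrow> marginal h S3 S1 \<ge> marginal h S3 S2)"

text \<open>
  The two loops of the algorithm are given by the sets of loop states reachable under
  some resolution of the argmax ties; a run's result is a reachable state at which the
  loop condition fails.
\<close>

inductive step1_state :: "'a set \<Rightarrow> ('a list \<Rightarrow> real) \<Rightarrow> nat \<Rightarrow> 'a list \<Rightarrow> bool"
  for V h \<tau> where
  init1: "step1_state V h \<tau> []"
| iter1: "\<lbrakk>step1_state V h \<tau> S1; card (set S1) < \<tau>;
           is_arg_max (\<lambda>v. h [v]) (\<lambda>v. v \<in> V - set S1) v\<rbrakk>
          \<Longrightarrow> step1_state V h \<tau> (S1 \<oplus> [v])"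

inductive step2_state ::
    "'a set \<Rightarrow> ('a list \<Rightarrow> real) \<Rightarrow> nat \<Rightarrow> nat \<Rightarrow> 'a list \<Rightarrow> 'a list \<Rightarrow> bool"
  for V h k \<tau> S1 where
  init2: "step2_state V h k \<tau> S1 []"
| iter2: "\<lbrakk>step2_state V h k \<tau> S1 S2; card (set S2) < k - \<tau>;
           is_arg_max (\<lambda>v. marginal h [v] S2) (\<lambda>v. v \<in> V - (set S1 \<union> set S2)) v\<rbrakk>
          \<Longrightarrow> step2_state V h k \<tau> S1 (S2 \<oplus> [v])"

definition algorithm2_output ::
    "'a set \<Rightarrow> ('a list \<Rightarrow> real) \<Rightarrow> nat \<Rightarrow> nat \<Rightarrow> 'a list \<Rightarrow> bool" where
  "algorithm2_output V h k \<tau> S \<longleftrightarrow>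
     (\<exists>S1 S2. step1_state V h \<tau> S1 \<and> \<not> card (set S1) < \<tau> \<and>
              step2_state V h k \<tau> S1 S2 \<and> \<not> card (set S2) < k - \<tau> \<and>
              S = S1 \<oplus> S2)"

definition robust_value :: "('a list \<Rightarrow> real) \<Rightarrow> nat \<Rightarrow> 'a list \<Rightarrow> real" where
  "robust_value h \<tau> S = Min ((\<lambda>V'. h (S \<ominus> V')) ` {V'. V' \<subseteq> set S \<and> card V' \<le> \<tau>})"

end

theory Submission
  imports Defs
begin

text \<open>
  Let \<open>m = k - \<tau>\<close>. Deleting from an optimal sequence its elements in \<open>S1\<close>, and further elements
  up to a total of \<open>\<tau>\<close>, leaves a sequence of length at most \<open>m\<close> that avoids \<open>S1\<close> and is worth at
  least the optimal robust value; the usual greedy argument then gives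
  \<open>h S2 \<ge> (1 - 1/e) OPT\<close>. Now let \<open>V'\<close> be deleted from \<open>S\<close>, and let \<open>U\<close> be its part in \<open>S2\<close>.
  If \<open>U\<close> is nonempty, some \<open>a\<close> of \<open>S1\<close> survives, and \<open>h (S \<ominus> V')\<close> dominates \<open>h [a]\<close>, hence
  \<open>h [u]\<close> for every \<open>u \<in> U\<close>. As it also dominates \<open>h (S2 \<ominus> U)\<close>, submodularity yields
  \<open>h S2 \<le> h (S2 \<ominus> U) + (\<Sum>u\<in>U. h [u]) \<le> (1 + \<tau>) h (S \<ominus> V')\<close>.
\<close>

section \<open>Deletion and concatenation of sequences\<close>

lemma set_del [simp]: "set (S \<ominus> U) = set S - U"
  by (auto simp: del_def)

lemma set_seq_concat [simp]: "set (A \<oplus> T) = set A \<union> set T"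
  by (auto simp: seq_concat_def)

lemma del_in_seqs: "S \<in> seqs V \<Longrightarrow> S \<ominus> U \<in> seqs V"
  by (auto simp: seqs_def del_def)

lemma seq_concat_in_seqs: "A \<in> seqs V \<Longrightarrow> T \<in> seqs V \<Longrightarrow> A \<oplus> T \<in> seqs V"
  by (auto simp: seqs_def seq_concat_def del_def)

lemma seq_concat_Nil [simp]: "A \<oplus> [] = A" "[] \<oplus> T = T"
  by (auto simp: seq_concat_def del_def)

lemma seq_concat_singleton: "A \<oplus> [v] = (if v \<in> set A then A else A @ [v])"
  by (simp add: seq_concat_def del_def)

lemma seq_concat_disjoint: "set A \<inter> set T = {} \<Longrightarrow> A \<oplus> T = A @ T"
  by (auto simp: seq_concat_def del_def filter_id_conv)

lemma seq_concat_snoc: "t \<notin> set T \<Longrightarrow> A \<oplus> (T @ [t]) = (A \<oplus> T) \<oplus> [t]"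
  by (auto simp: seq_concat_def del_def)

lemma seqs_snoc: "T @ [t] \<in> seqs V \<longleftrightarrow> T \<in> seqs V \<and> t \<in> V \<and> t \<notin> set T"
  by (auto simp: seqs_def)

lemma del_append: "(A @ B) \<ominus> U = (A \<ominus> U) @ (B \<ominus> U)"
  by (simp add: del_def)

lemma is_subsequence_del: "is_subsequence (S \<ominus> U) S"
proof -
  \<comment> \<open>\<open>is_subsequence\<close> asks for a deleted set inside
    \<open>set S\<close>, so \<open>U\<close> is first cut down to it.\<close>
  have "S \<ominus> U = S \<ominus> (U \<inter> set S)"
    unfolding del_def by (rule filter_cong) auto
  then show ?thesis
    unfolding is_subsequence_def by blast
qed

lemma is_subsequence_seq_concat: "is_subsequence A (A \<oplus> T)"
proof -
  have "A = (A \<oplus> T) \<ominus> (set T - set A)"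
    by (auto simp: seq_concat_def del_def filter_id_conv filter_empty_conv)
  then show ?thesis
    unfolding is_subsequence_def by (metis Diff_subset le_supI2 set_seq_concat)
qed

lemma finite_seqs: "finite V \<Longrightarrow> finite (seqs V)"
  unfolding seqs_def
  using finite_subset_distinct[of V] by (simp add: conj_commute)

section \<open>Robust values and invariants of the two loops\<close>

lemma robust_value_le:
  assumes "U \<subseteq> set S" "card U \<le> \<tau>"
  shows "robust_value h \<tau> S \<le> h (S \<ominus> U)"
  unfolding robust_value_def
proof (rule Min_le)
  show "finite ((\<lambda>V'. h (S \<ominus> V')) ` {V'. V' \<subseteq> set S \<and> card V' \<le> \<tau>})"
    by (rule finite_imageI, rule finite_subset[of _ "Pow (set S)"]) auto
qed (use assms in auto)

lemma robust_value_geI: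
  assumes "\<And>U. U \<subseteq> set S \<Longrightarrow> card U \<le> \<tau> \<Longrightarrow> c \<le> h (S \<ominus> U)"
  shows "c \<le> robust_value h \<tau> S"
proof -
  have "finite {V'. V' \<subseteq> set S \<and> card V' \<le> \<tau>}"
    by (rule finite_subset[of _ "Pow (set S)"]) auto
  moreover have "{} \<in> {V'. V' \<subseteq> set S \<and> card V' \<le> \<tau>}"
    by simp
  ultimately show ?thesis
    unfolding robust_value_def using assms by (subst Min_ge_iff) auto
qed

text \<open>The invariant survives an iteration because the new element is a best remaining one and
  the set of outsiders only shrinks.\<close>

lemma step1_state_greedy:
  assumes "step1_state V h \<tau> S1"
  shows "S1 \<in> seqs V \<and> card (set S1) \<le> \<tau> \<and> (\<forall>a \<in> set S1. \<forall>w \<in> V - set S1. h [w] \<le> h [a])"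
  using assms
proof induction
  case init1
  then show ?case by (simp add: seqs_def)
next
  case (iter1 S1 v)
  then have "v \<in> V" "v \<notin> set S1" "\<And>w. w \<in> V - set S1 \<Longrightarrow> h [w] \<le> h [v]"
    by (auto simp: is_arg_max_linorder)
  with iter1 show ?case
    by (auto simp: seq_concat_singleton seqs_snoc)
qed

lemma step2_state_seqs:
  assumes "step2_state V h k \<tau> S1 S2"
  shows "S2 \<in> seqs V \<and> set S2 \<inter> set S1 = {} \<and> card (set S2) \<le> k - \<tau>"
  using assms
proof induction
  case init2
  then show ?case by (simp add: seqs_def)
next
  case (iter2 S2 v)
  then have "v \<in> V" "v \<notin> set S1" "v \<notin> set S2"
    by (auto simp: is_arg_max_linorder)
  with iter2 show ?case
    by (auto simp: seq_concat_singleton seqs_snoc)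
qed

section \<open>Consequences of monotonicity and submodularity\<close>

locale monotone_sequence_submodular =
  fixes V :: "'a set" and h :: "'a list \<Rightarrow> real"
  assumes forward: "forward_monotone V h"
    and backward: "backward_monotone V h"
    and submodular: "general_sequence_submodular V h"
    and empty [simp]: "h [] = 0"
begin

lemma forwardD: "A \<in> seqs V \<Longrightarrow> T \<in> seqs V \<Longrightarrow> h A \<le> h (A \<oplus> T)"
  using forward by (auto simp: forward_monotone_def)

lemma backwardD: "A \<in> seqs V \<Longrightarrow> T \<in> seqs V \<Longrightarrow> h T \<le> h (A \<oplus> T)"
  using backward by (auto simp: backward_monotone_def)

lemma marginal_antimono:
  "A \<in> seqs V \<Longrightarrow> B \<in> seqs V \<Longrightarrow> T \<in> seqs V \<Longrightarrow> is_subsequence A B \<Longrightarrow>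
    marginal h T B \<le> marginal h T A"
  using submodular by (auto simp: general_sequence_submodular_def)

lemma marginal_nonneg: "A \<in> seqs V \<Longrightarrow> T \<in> seqs V \<Longrightarrow> 0 \<le> marginal h T A"
  by (simp add: marginal_def forwardD)

lemma nonneg: "A \<in> seqs V \<Longrightarrow> 0 \<le> h A"
  using forwardD[of "[]" A] by (simp add: seqs_def)

lemma singleton_in_seqs: "v \<in> V \<Longrightarrow> [v] \<in> seqs V"
  by (simp add: seqs_def)

text \<open>Append \<open>T\<close> one element at a time: \<open>A\<close> is a subsequence of
  \<open>A\<close> followed by any prefix of \<open>T\<close>, so each gain is at most the gain over
  \<open>A\<close> alone.\<close>

lemma seq_concat_le_sum_marginals:
  assumes "A \<in> seqs V" "T \<in> seqs V"
  shows "h (A \<oplus> T) \<le> h A + (\<Sum>t\<in>set T. marginal h [t] A)"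
  using assms(2)
proof (induction T rule: rev_induct)
  case (snoc t T)
  then have T: "T \<in> seqs V" "t \<in> V" "t \<notin> set T"
    by (auto simp: seqs_snoc)
  have "marginal h [t] (A \<oplus> T) \<le> marginal h [t] A"
    using T assms(1)
    by (intro marginal_antimono seq_concat_in_seqs singleton_in_seqs is_subsequence_seq_concat) auto
  with snoc.IH T show ?case
    by (simp add: seq_concat_snoc marginal_def)
qed simp

text \<open>Build \<open>S\<close> from left to right: by submodularity a deleted element gains at
  most its value over \<open>[]\<close>, and a kept one at most what it gains over the thinned
  prefix.\<close>

lemma le_del_plus_singletons:
  assumes "S \<in> seqs V"
  shows "h S \<le> h (S \<ominus> U) + (\<Sum>u\<in>set S \<inter> U. h [u])"
  using assms
proof (induction S rule: rev_induct)
  case Nil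
  then show ?case by (simp add: del_def)
next
  case (snoc v S)
  then have S: "S \<in> seqs V" "v \<in> V" "v \<notin> set S"
    by (auto simp: seqs_snoc)
  note v = singleton_in_seqs[OF S(2)]
  have snoc_h: "h (S @ [v]) = h S + marginal h [v] S"
    using S by (simp add: marginal_def seq_concat_singleton)
  show ?case
  proof (cases "v \<in> U")
    case True
    have "marginal h [v] S \<le> marginal h [v] []"
      using S v is_subsequence_seq_concat[of "[]" S]
      by (intro marginal_antimono) (auto simp: seqs_def)
    then have "marginal h [v] S \<le> h [v]"
      by (simp add: marginal_def)
    moreover have "(S @ [v]) \<ominus> U = S \<ominus> U" "set (S @ [v]) \<inter> U = insert v (set S \<inter> U)"
      using True by (auto simp: del_def)
    ultimately show ?thesis
      using snoc.IH S snoc_h by simp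
  next
    case False
    have "marginal h [v] S \<le> marginal h [v] (S \<ominus> U)"
      using S v by (intro marginal_antimono is_subsequence_del del_in_seqs)
    moreover have "(S @ [v]) \<ominus> U = (S \<ominus> U) \<oplus> [v]" "set (S @ [v]) \<inter> U = set S \<inter> U"
      using False S by (auto simp: del_def seq_concat_singleton)
    ultimately show ?thesis
      using snoc.IH S snoc_h by (simp add: marginal_def)
  qed
qed

section \<open>The greedy guarantee for the second loop\<close>

text \<open>Each iteration shrinks the gap to \<open>h T\<close> by the factor
  \<open>1 - 1 / (k - \<tau>)\<close>: the greedy gain is at least the average gain over the
  elements of \<open>T\<close>. Disjointness from \<open>S1\<close> makes every element of
  \<open>T\<close> not yet chosen a candidate of the argmax.\<close>

lemma greedy_gap:
  assumes "step2_state V h k \<tau> S1 S2" and "\<tau> < k"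
    and T: "T \<in> seqs V" "set T \<inter> set S1 = {}" "card (set T) \<le> k - \<tau>"
  shows "h T - h S2 \<le> (1 - 1 / real (k - \<tau>)) ^ card (set S2) * h T"
  using assms(1)
proof induction
  case init2
  then show ?case by simp
next
  case (iter2 S v)
  define m where "m = real (k - \<tau>)"
  have m: "1 \<le> m"
    using \<open>\<tau> < k\<close> by (simp add: m_def)
  have v: "v \<in> V" "v \<notin> set S1" "v \<notin> set S"
    and max: "\<And>w. w \<in> V - (set S1 \<union> set S) \<Longrightarrow> marginal h [w] S \<le> marginal h [v] S"
    using iter2.hyps by (auto simp: is_arg_max_linorder)
  have S: "S \<in> seqs V"
    using step2_state_seqs[OF iter2.hyps(1)] by simp
  have gain: "0 \<le> marginal h [v] S"
    using S v by (intro marginal_nonneg singleton_in_seqs)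
  have "marginal h [t] S \<le> marginal h [v] S" if "t \<in> set T" for t
  \<comment> \<open>Elements already chosen are outside the argmax, but their marginal value is
    zero.\<close>
  proof (cases "t \<in> set S")
    case True
    then have "marginal h [t] S = 0"
      by (simp add: marginal_def seq_concat_singleton)
    with gain show ?thesis by simp
  next
    case False
    then show ?thesis
      using that T by (intro max) (auto simp: seqs_def)
  qed
  then have "(\<Sum>t\<in>set T. marginal h [t] S) \<le> real (card (set T)) * marginal h [v] S"
    by (intro sum_bounded_above)
  also have "\<dots> \<le> m * marginal h [v] S"
    using T(3) gain by (intro mult_right_mono) (auto simp: m_def)
  \<comment> \<open>Backward monotonicity replaces \<open>h (S \<oplus> T)\<close> by the smaller
    \<open>h T\<close>.\<close>
  finally have "h T - h S \<le> m * marginal h [v] S"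
    using seq_concat_le_sum_marginals[OF S T(1)] backwardD[OF S T(1)] by simp
  then have "(h T - h S) / m \<le> marginal h [v] S"
    using m by (simp add: field_simps)
  then have "h T - h (S \<oplus> [v]) \<le> (1 - 1 / m) * (h T - h S)"
    by (simp add: marginal_def algebra_simps diff_divide_distrib)
  also have "\<dots> \<le> (1 - 1 / m) * ((1 - 1 / m) ^ card (set S) * h T)"
    using iter2.IH m by (intro mult_left_mono) (auto simp: m_def)
  finally show ?case
    using v by (simp add: m_def mult.assoc)
qed

lemma greedy_bound:
  assumes "step2_state V h k \<tau> S1 S2" "\<not> card (set S2) < k - \<tau>"
    and T: "T \<in> seqs V" "set T \<inter> set S1 = {}" "card (set T) \<le> k - \<tau>"
  shows "(1 - 1 / exp 1) * h T \<le> h S2"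
proof (cases "\<tau> < k")
  \<comment> \<open>Here the truncated difference \<open>k - \<tau>\<close> is 0, which forces
    \<open>T\<close> to be empty.\<close>
  case False
  then have "T = []"
    using T(3) by simp
  then show ?thesis
    using nonneg step2_state_seqs[OF assms(1)] by simp
next
  case True
  define m where "m = k - \<tau>"
  have m: "m > 0"
    using True by (simp add: m_def)
  have card: "card (set S2) = m"
    using assms(2) step2_state_seqs[OF assms(1)] by (simp add: m_def)
  have "1 - 1 / real m \<le> exp (- (1 / real m))"
    using exp_ge_add_one_self[of "- (1 / real m)"] by simp
  then have "(1 - 1 / real m) ^ m \<le> exp (- (1 / real m)) ^ m"
    using m by (intro power_mono) auto
  also have "\<dots> = 1 / exp 1"
    using m by (subst exp_of_nat_mult [symmetric]) (simp add: exp_minus inverse_eq_divide)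
  finally have "(1 - 1 / real m) ^ m * h T \<le> 1 / exp 1 * h T"
    using nonneg[OF T(1)] by (rule mult_right_mono)
  then show ?thesis
    using greedy_gap[OF assms(1) True T] card by (simp add: m_def algebra_simps)
qed

lemma robust_value_le_greedy:
  assumes "S1 \<in> seqs V" "card (set S1) \<le> \<tau>"
    and "step2_state V h k \<tau> S1 S2" "\<not> card (set S2) < k - \<tau>"
    and T: "T \<in> seqs V" "card (set T) \<le> k"
  shows "(1 - 1 / exp 1) * robust_value h \<tau> T \<le> h S2"
proof -
  \<comment> \<open>\<open>U\<close> removes everything that \<open>T\<close> shares with
    \<open>S1\<close> and is padded to size \<open>\<tau>\<close>, or to all of \<open>T\<close> if
    \<open>T\<close> is shorter, so at most \<open>k - \<tau>\<close> elements survive.\<close>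
  obtain U where U: "set T \<inter> set S1 \<subseteq> U" "U \<subseteq> set T" "card U = min \<tau> (card (set T))"
  proof -
    have "card (set T \<inter> set S1) \<le> card (set S1)"
      by (intro card_mono) auto
    then have "card (set T \<inter> set S1) \<le> min \<tau> (card (set T))"
      using assms(2) by (auto intro: card_mono)
    then show thesis
      using exists_subset_between[of "set T \<inter> set S1" "min \<tau> (card (set T))" "set T"] that
      by auto
  qed
  have "card (set (T \<ominus> U)) \<le> k - \<tau>"
    using U T(2) by (simp add: card_Diff_subset finite_subset)
  then have "(1 - 1 / exp 1) * h (T \<ominus> U) \<le> h S2"
    using U T by (intro greedy_bound[OF assms(3,4)] del_in_seqs) auto
  moreover have "robust_value h \<tau> T \<le> h (T \<ominus> U)"
    using U by (intro robust_value_le) auto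
  then have "(1 - 1 / exp 1) * robust_value h \<tau> T \<le> (1 - 1 / exp 1) * h (T \<ominus> U)"
    by (intro mult_left_mono) auto
  ultimately show ?thesis by linarith
qed

section \<open>Robustness of the combined sequence\<close>

lemma le_robust_value_seq_concat:
  assumes S1: "S1 \<in> seqs V" "card (set S1) = \<tau>"
    and top: "\<And>a w. a \<in> set S1 \<Longrightarrow> w \<in> V - set S1 \<Longrightarrow> h [w] \<le> h [a]"
    and S2: "S2 \<in> seqs V" "set S2 \<inter> set S1 = {}"
  shows "h S2 / (1 + real \<tau>) \<le> robust_value h \<tau> (S1 \<oplus> S2)"
proof (rule robust_value_geI)
  fix U assume U: "U \<subseteq> set (S1 \<oplus> S2)" "card U \<le> \<tau>"
  define A B where "A = S1 \<ominus> U" and "B = S2 \<ominus> U"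
  have seqs: "A \<in> seqs V" "B \<in> seqs V"
    using S1 S2 by (simp_all add: A_def B_def del_in_seqs)
  have AB: "(S1 \<oplus> S2) \<ominus> U = A \<oplus> B"
    using S2 by (subst (1 2) seq_concat_disjoint) (auto simp: A_def B_def del_append)
  have finU: "finite U"
    using U(1) by (rule finite_subset) simp
  have le: "h [u] \<le> h (A \<oplus> B)" if u: "u \<in> set S2 \<inter> U" for u
  proof -
    \<comment> \<open>Deleting all of \<open>S1\<close> would use up the whole budget
      \<open>\<tau>\<close> and leave none for \<open>u\<close>, which lies in
      \<open>S2\<close>.\<close>
    have "\<not> set S1 \<subseteq> U"
    proof
      assume "set S1 \<subseteq> U"
      then have "set S1 = U"
        using U(2) S1(2) finU by (metis card_seteq)
      then show False
        using u S2 by auto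
    qed
    then obtain a A' where A: "A = a # A'"
      by (cases A) (auto simp: A_def del_def filter_empty_conv)
    then have a: "a \<in> set S1"
      by (metis A_def DiffD1 list.set_intros(1) set_del)
    have "h [u] \<le> h [a]"
      using u a S2 by (intro top) (auto simp: seqs_def)
    also have "\<dots> \<le> h ([a] \<oplus> A')"
      using seqs A by (intro forwardD) (auto simp: seqs_def)
    also have "[a] \<oplus> A' = A"
      using seqs A by (subst seq_concat_disjoint) (auto simp: seqs_def)
    also have "h A \<le> h (A \<oplus> B)"
      using seqs by (rule forwardD)
    finally show ?thesis .
  qed
  have "h S2 \<le> h B + (\<Sum>u\<in>set S2 \<inter> U. h [u])"
    unfolding B_def using S2(1) by (rule le_del_plus_singletons)
  \<comment> \<open>The factor \<open>1 + \<tau>\<close> arises here: one copy of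
    \<open>h (A \<oplus> B)\<close> pays for \<open>B\<close>, and one for each deleted element of
    \<open>S2\<close>.\<close>
  also have "\<dots> \<le> h (A \<oplus> B) + real (card (set S2 \<inter> U)) * h (A \<oplus> B)"
    using seqs le by (intro add_mono backwardD sum_bounded_above)
  also have "card (set S2 \<inter> U) \<le> \<tau>"
    using U(2) finU by (meson card_mono inf_le2 le_trans)
  then have "real (card (set S2 \<inter> U)) * h (A \<oplus> B) \<le> real \<tau> * h (A \<oplus> B)"
    using seqs by (intro mult_right_mono nonneg seq_concat_in_seqs) auto
  finally show "h S2 / (1 + real \<tau>) \<le> h ((S1 \<oplus> S2) \<ominus> U)"
    by (simp add: AB field_simps)
qed

end

theorem theorem3:
  fixes V :: "'a set" and h :: "'a list \<Rightarrow> real" and k \<tau> :: nat and S :: "'a list"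
  assumes "finite V"
    and "k \<ge> 2" and "1 \<le> \<tau>" and "\<tau> \<le> k" and "card V \<ge> k"
    and "\<forall>T \<in> seqs V. h T \<ge> 0"
    and "h [] = 0"
    and "forward_monotone V h"
    and "backward_monotone V h"
    and "general_sequence_submodular V h"
    and "algorithm2_output V h k \<tau> S"
  shows "robust_value h \<tau> S \<ge>
    (1 - 1 / exp 1) / (1 + real \<tau>) *
      Max (robust_value h \<tau> ` {S' \<in> seqs V. card (set S') \<le> k})"
proof -
  interpret monotone_sequence_submodular V h
    using assms by unfold_locales
  obtain S1 S2 where S1: "step1_state V h \<tau> S1" "\<not> card (set S1) < \<tau>"
    and S2: "step2_state V h k \<tau> S1 S2" "\<not> card (set S2) < k - \<tau>"
    and S: "S = S1 \<oplus> S2"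
    using \<open>algorithm2_output V h k \<tau> S\<close> by (auto simp: algorithm2_output_def)
  note S1' = step1_state_greedy[OF S1(1)] and S2' = step2_state_seqs[OF S2(1)]
  \<comment> \<open>The empty sequence shows that the maximum ranges over a nonempty set, so some
    \<open>T\<close> attains it.\<close>
  have "[] \<in> {S' \<in> seqs V. card (set S') \<le> k}"
    by (simp add: seqs_def)
  then have "Max (robust_value h \<tau> ` {S' \<in> seqs V. card (set S') \<le> k})
      \<in> robust_value h \<tau> ` {S' \<in> seqs V. card (set S') \<le> k}"
    using finite_seqs[OF \<open>finite V\<close>] by (intro Max_in) auto
  then obtain T where T: "T \<in> seqs V" "card (set T) \<le> k"
    and Max: "Max (robust_value h \<tau> ` {S' \<in> seqs V. card (set S') \<le> k}) = robust_value h \<tau> T"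
    by blast
  have "(1 - 1 / exp 1) * robust_value h \<tau> T \<le> h S2"
    using S1' S2 T by (intro robust_value_le_greedy) auto
  then have "(1 - 1 / exp 1) / (1 + real \<tau>) * robust_value h \<tau> T \<le> h S2 / (1 + real \<tau>)"
    by (simp add: divide_right_mono)
  also have "\<dots> \<le> robust_value h \<tau> S"
    unfolding S using S1' S1(2) S2' by (intro le_robust_value_seq_concat) auto
  finally show ?thesis
    unfolding Max .
qed

end
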